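(* Let $n,k\in\mathbb{N}$ with $\ln n\ge k\ge 2$, let $X$ be a set with $|X|=n$, let $L\ge 2e$ and let $r$ be a real number with $r\ge L^k$. Let $E\subseteq\binom{X}{k}$ with $d:=|E|\ge r$, let $g\colon\binom{X}{k}\to[0,1]$ be given by $g(S)=\frac1r$ for $S\in E$ and $g(S)=0$ otherwise, and let $p\in[0,1]$ satisfy $w(g,p)=1$. Let $e_{1,1},e_{1,2}$ be chosen independently and uniformly at random from $E$, and let $Y_2:=|e_{1,1}\cap e_{1,2}|$. Suppose that $$\mathbb{P}(Y_2=y)\cdot r^{2-\frac{y}{k}}\cdot d^{\frac{y}{k}}\le L^k\qquad\text{for all } y\in\{1,\dots,k-1\}.$$ Then there exists $G\subseteq 2^X\setminus\{\emptyset\}$ with $\langle g\rangle\subseteq\langle G\rangle$ and $w(G,p/L)\le 1$.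
   Context: For a finite set $X$ and $h\colon 2^X\to[0,1]$ (a function defined on $\binom{X}{k}$ is extended by $0$ to all of $2^X$), define $\langle h\rangle:=\{S\subseteq X:\sum_{T\subseteq S}h(T)\ge 1\}$ and $w(h,p):=\sum_{S\subseteq X}h(S)p^{|S|}$. For a family $G\subseteq 2^X$, $\langle G\rangle:=\{S\subseteq X:\exists T\in G,\ T\subseteq S\}$ and $w(G,p):=\sum_{S\in G}p^{|S|}$. *)

theory Defs
  imports "HOL-Library.Ramsey" "HOL-Probability.Probability"
begin

(* The ground set X is an explicit carrier. Functions on 2^X are total functions on
   'a set whose values outside Pow X are never inspected. *)

definition frac_upset :: "'a set \<Rightarrow> ('a set \<Rightarrow> real) \<Rightarrow> 'a set set" where
  "frac_upset X h = {S. S \<subseteq> X \<and> (\<Sum>T\<in>Pow S. h T) \<ge> 1}"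

definition frac_weight :: "'a set \<Rightarrow> ('a set \<Rightarrow> real) \<Rightarrow> real \<Rightarrow> real" where
  "frac_weight X h p = (\<Sum>S\<in>Pow X. h S * p ^ card S)"

definition upset :: "'a set \<Rightarrow> 'a set set \<Rightarrow> 'a set set" where
  "upset X G = {S. S \<subseteq> X \<and> (\<exists>T\<in>G. T \<subseteq> S)}"

definition weight :: "'a set set \<Rightarrow> real \<Rightarrow> real" where
  "weight G p = (\<Sum>S\<in>G. p ^ card S)"

end

theory Submission
  imports Defs
begin

text \<open>
  Put \<open>q = p / L\<close>. A set \<open>S\<close> in \<open>\<langle>g\<rangle>\<close> contains at least \<open>r\<close> edges. Either two of them meet in
  \<open>y \<in> {1..k-1}\<close> points, and \<open>S\<close> contains their union, or \<open>S\<close> contains \<open>m = \<lceil>r\<rceil>\<close> pairwise disjoint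
  edges. Since \<open>p ^ k = r / d\<close>, the hypothesis says precisely that the ordered pairs of edges
  meeting in \<open>y\<close> points have total weight at most \<open>L ^ k\<close> at \<open>p\<close>, hence at most \<open>L ^ y / L ^ k\<close>
  at \<open>q\<close>, and these bounds sum to at most \<open>1/2\<close>. The unions of \<open>m\<close> disjoint edges have weight at
  most \<open>(d choose m) * q ^ (k * m) \<le> r ^ m / m! / L ^ (k * m) \<le> (e / L ^ k) ^ m \<le> 1/2\<close>.
\<close>

section \<open>Weights of families and elementary power estimates\<close>

lemma weight_image_le:
  assumes "finite I" "0 \<le> q"
  shows "weight (f ` I) q \<le> (\<Sum>i\<in>I. q ^ card (f i))"
  unfolding weight_def using sum_image_le[of I "\<lambda>S. q ^ card S" f] assms by (simp add: o_def)

lemma weight_Un_le: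
  assumes "finite G" "finite H" "0 \<le> q"
  shows "weight (G \<union> H) q \<le> weight G q + weight H q"
proof -
  have "0 \<le> (\<Sum>S\<in>G \<inter> H. q ^ card S)"
    using assms(3) by (simp add: sum_nonneg)
  then show ?thesis
    unfolding weight_def using sum.union_inter[OF assms(1,2), of "\<lambda>S. q ^ card S"] by linarith
qed

text \<open>Induction: the new term \<open>2 * x ^ k\<close> raises the bound from
  \<open>x ^ k\<close> to \<open>3 * x ^ k\<close>, which \<open>3 \<le> x\<close> absorbs into
  \<open>x ^ Suc k\<close>.\<close>

lemma two_sum_power_le:
  fixes x :: real
  assumes "3 \<le> x"
  shows "2 * (\<Sum>i\<in>{1..<k}. x ^ i) \<le> x ^ k"
proof (induction k)
  case (Suc k)
  show ?case
  proof (cases "k = 0")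
    case False
    then have "2 * (\<Sum>i\<in>{1..<Suc k}. x ^ i) = 2 * (\<Sum>i\<in>{1..<k}. x ^ i) + 2 * x ^ k"
      by (simp add: atLeastLessThanSuc)
    also have "\<dots> \<le> 3 * x ^ k"
      using Suc.IH by simp
    also have "\<dots> \<le> x ^ Suc k"
      using assms by (simp add: mult_right_mono)
    finally show ?thesis .
  qed (use assms in simp)
qed simp

text \<open>The left side is a single term of the exponential series, all of whose terms are
  nonnegative.\<close>

lemma power_over_fact_le_exp:
  fixes x :: real
  assumes "0 \<le> x"
  shows "x ^ m / fact m \<le> exp x"
proof -
  have "(\<Sum>i\<in>{m}. x ^ i /\<^sub>R fact i) \<le> (\<Sum>i. x ^ i /\<^sub>R fact i)"
    by (rule sum_le_suminf) (use assms summable_exp_generic[of x] in auto)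
  then show ?thesis
    by (simp add: exp_def divide_inverse mult.commute)
qed

text \<open>Meant for \<open>t = r / d\<close>, where the bound becomes \<open>exp r\<close>, free
  of \<open>d\<close> and \<open>m\<close>.\<close>

lemma choose_mult_power_le_exp:
  fixes t :: real
  assumes "0 \<le> t"
  shows "real (d choose m) * t ^ m \<le> exp (real d * t)"
proof -
  have "real (d choose m) * fact m \<le> real d ^ m"
    using binomial_fact_pow[of d m] by (metis of_nat_fact of_nat_le_iff of_nat_mult of_nat_power)
  then have "real (d choose m) \<le> real d ^ m / fact m"
    by (simp add: field_simps)
  then have "real (d choose m) * t ^ m \<le> real d ^ m / fact m * t ^ m"
    using assms by (intro mult_right_mono) auto
  also have "\<dots> = (real d * t) ^ m / fact m"
    by (simp add: power_mult_distrib)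
  also have "\<dots> \<le> exp (real d * t)"
    using assms by (intro power_over_fact_le_exp) simp
  finally show ?thesis .
qed

text \<open>Disjointness serves only to give every union exactly \<open>k * m\<close> points; the
  count then runs over all \<open>m\<close>-subsets of \<open>E\<close>.\<close>

lemma weight_disjoint_unions_le:
  assumes "finite E" "\<And>e. e \<in> E \<Longrightarrow> finite e \<and> card e = k" "0 \<le> q"
  shows "weight (\<Union> ` {A. A \<subseteq> E \<and> card A = m \<and> pairwise disjnt A}) q
           \<le> real (card E choose m) * (q ^ k) ^ m"
proof -
  let ?I = "{A. A \<subseteq> E \<and> card A = m \<and> pairwise disjnt A}"
  have fin: "finite ?I"
    by (rule finite_subset[of _ "Pow E"]) (use assms(1) in auto)
  have card_Un: "card (\<Union>A) = k * m" if "A \<in> ?I" for A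
  proof -
    have "card (\<Union>A) = sum card A"
      by (rule card_Union_disjoint) (use that assms(2) in auto)
    also have "\<dots> = (\<Sum>e\<in>A. k)"
      by (rule sum.cong) (use that assms(2) in auto)
    finally show ?thesis
      using that by simp
  qed
  have "weight (\<Union> ` ?I) q \<le> (\<Sum>A\<in>?I. q ^ card (\<Union>A))"
    by (rule weight_image_le) (use fin assms in auto)
  also have "\<dots> = real (card ?I) * (q ^ k) ^ m"
    using card_Un by (simp add: power_mult)
  also have "\<dots> \<le> real (card {A. A \<subseteq> E \<and> card A = m}) * (q ^ k) ^ m"
    using assms by (intro mult_right_mono of_nat_mono card_mono) auto
  finally show ?thesis
    using n_subsets[OF assms(1)] by simp
qed

text \<open>Ordered pairs, so that dividing their number by \<open>card E ^ 2\<close> gives a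
  probability.\<close>

definition pairs_meeting_in :: "'a set set \<Rightarrow> nat \<Rightarrow> ('a set \<times> 'a set) set" where
  "pairs_meeting_in E y = {(a, b). a \<in> E \<and> b \<in> E \<and> card (a \<inter> b) = y}"

lemma pairs_meeting_in_subset: "pairs_meeting_in E y \<subseteq> E \<times> E"
  by (auto simp: pairs_meeting_in_def)

text \<open>Inclusion-exclusion fixes the size of each union, and a pair determines its
  \<open>y\<close>, so the sum splits over \<open>y\<close>.\<close>

lemma weight_pair_unions_le:
  assumes "finite E" "\<And>e. e \<in> E \<Longrightarrow> finite e \<and> card e = k" "0 \<le> q"
  shows "weight ((\<lambda>(a, b). a \<union> b) ` (\<Union>y\<in>{1..<k}. pairs_meeting_in E y)) q
           \<le> (\<Sum>y\<in>{1..<k}. real (card (pairs_meeting_in E y)) * q ^ (2 * k - y))"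
proof -
  have fin: "finite (pairs_meeting_in E y)" for y
    using pairs_meeting_in_subset assms(1) by (metis finite_SigmaI finite_subset)
  have card_un: "card (a \<union> b) = 2 * k - y" if "(a, b) \<in> pairs_meeting_in E y" for a b y
    using that card_Un_Int[of a b] assms(2)[of a] assms(2)[of b]
    by (auto simp: pairs_meeting_in_def)
  have "weight ((\<lambda>(a, b). a \<union> b) ` (\<Union>y\<in>{1..<k}. pairs_meeting_in E y)) q
      \<le> (\<Sum>z\<in>(\<Union>y\<in>{1..<k}. pairs_meeting_in E y). q ^ card (case z of (a, b) \<Rightarrow> a \<union> b))"
    by (rule weight_image_le) (use fin assms in auto)
  also have "\<dots> = (\<Sum>y\<in>{1..<k}. \<Sum>z\<in>pairs_meeting_in E y. q ^ card (case z of (a, b) \<Rightarrow> a \<union> b))"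
    by (rule sum.UNION_disjoint) (use fin in \<open>auto simp: pairs_meeting_in_def\<close>)
  also have "\<dots> = (\<Sum>y\<in>{1..<k}. \<Sum>z\<in>pairs_meeting_in E y. q ^ (2 * k - y))"
    by (intro sum.cong) (auto simp: card_un)
  finally show ?thesis
    by simp
qed

lemma prob_card_Int_eq:
  assumes "finite E" "E \<noteq> {}"
  shows "measure_pmf.prob (pair_pmf (pmf_of_set E) (pmf_of_set E))
             {\<omega>. (\<lambda>(a, b). card (a \<inter> b)) \<omega> = y}
           = real (card (pairs_meeting_in E y)) / real (card E) ^ 2"
proof -
  have "pair_pmf (pmf_of_set E) (pmf_of_set E) = pmf_of_set (E \<times> E)"
    by (rule pmf_eqI) (auto simp: pmf_pair assms pmf_of_set indicator_def card_cartesian_product)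
  moreover have "(E \<times> E) \<inter> {\<omega>. (\<lambda>(a, b). card (a \<inter> b)) \<omega> = y} = pairs_meeting_in E y"
    by (auto simp: pairs_meeting_in_def)
  ultimately show ?thesis
    using assms by (simp add: measure_pmf_of_set card_cartesian_product power2_eq_square)
qed

text \<open>Rewrites the weight at \<open>p\<close> of one union in the form of the hypothesis on
  \<open>Y\<^sub>2\<close>; the factor \<open>1 / d ^ 2\<close> will turn the number of pairs into a
  probability.\<close>

lemma power_eq_powr_ratio:
  fixes p r d :: real
  assumes "0 \<le> p" "0 < r" "0 < d" "0 < k" "y \<le> 2 * k" "p ^ k = r / d"
  shows "p ^ (2 * k - y) = r powr (2 - real y / real k) * d powr (real y / real k) / d ^ 2"
proof -
  \<comment> \<open>\<open>p = 0\<close> would give \<open>p ^ k = 0\<close>, whereas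
    \<open>r / d\<close> is positive. Real exponents need a positive base.\<close>
  have "p > 0"
    using assms by (metis divide_pos_pos less_eq_real_def less_irrefl zero_power)
  have expo: "real (2 * k - y) = real k * (2 - real y / real k)"
    using assms by (simp add: field_simps of_nat_diff)
  have "p ^ (2 * k - y) = p powr (real k * (2 - real y / real k))"
    using \<open>p > 0\<close> by (simp only: expo[symmetric] powr_realpow)
  also have "\<dots> = (r / d) powr (2 - real y / real k)"
    using \<open>p > 0\<close> assms(6) by (simp add: powr_powr[symmetric] powr_realpow)
  also have "\<dots> = r powr (2 - real y / real k) / d powr (2 - real y / real k)"
    using assms by (simp add: powr_divide)
  also have "d powr (2 - real y / real k) = d ^ 2 / d powr (real y / real k)"
    using assms by (simp add: powr_diff)
  finally show ?thesis
    by simp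
qed

theorem theorem5:
  fixes n k d :: nat and X :: "'a set" and L r p :: real
    and E :: "'a set set" and g :: "'a set \<Rightarrow> real"
    and Y\<^sub>2 :: "'a set \<times> 'a set \<Rightarrow> nat"
  assumes "ln (real n) \<ge> real k" and "k \<ge> 2"
    and "finite X" and "card X = n"
    and "L \<ge> 2 * exp 1" and "r \<ge> L ^ k"
    and "E \<subseteq> nsets X k" and "d = card E" and "real d \<ge> r"
    and "g = (\<lambda>S. if S \<in> E then 1 / r else 0)"
    and "p \<in> {0..1}" and "frac_weight X g p = 1"
    and "Y\<^sub>2 = (\<lambda>(e11, e12). card (e11 \<inter> e12))"
    and "\<forall>y\<in>{1..k - 1}.
           measure_pmf.prob (pair_pmf (pmf_of_set E) (pmf_of_set E)) {\<omega>. Y\<^sub>2 \<omega> = y}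
             * r powr (2 - real y / real k) * real d powr (real y / real k) \<le> L ^ k"
  shows "\<exists>G. G \<subseteq> Pow X - {{}} \<and> frac_upset X g \<subseteq> upset X G \<and> weight G (p / L) \<le> 1"
proof -
  have E_edge: "e \<subseteq> X" "finite e" "card e = k" "e \<noteq> {}" if "e \<in> E" for e
    using that assms(2,7) by (auto simp: nsets_def)
  have E_Pow: "E \<subseteq> Pow X"
    using E_edge by auto
  have fin_E: "finite E"
    using E_Pow assms(3) finite_subset by blast
  have L: "L \<ge> 4"
    using assms(5) exp_ge_add_one_self[of 1] by simp
  have Lk: "L ^ k \<ge> 2 * exp 1"
    using power_increasing[of 1 k L] assms(2,5) L by simp
  have r: "r > 0"
    using Lk assms(6) exp_gt_zero[of 1] by linarith
  have d: "real d > 0"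
    using r assms(9) by linarith
  have E_ne: "E \<noteq> {}"
    using d assms(8) by auto
  have p: "p \<ge> 0"
    using assms(11) by simp
  \<comment> \<open>All \<open>d\<close> edges have size \<open>k\<close> and value
    \<open>1 / r\<close>, so the normalisation reads \<open>d * p ^ k / r = 1\<close>.\<close>
  have pk: "p ^ k = r / real d"
  proof -
    have "frac_weight X g p = (\<Sum>S\<in>Pow X. if S \<in> E then p ^ k / r else 0)"
      unfolding frac_weight_def assms(10) by (rule sum.cong) (auto simp: E_edge)
    also have "\<dots> = real d * (p ^ k / r)"
      using E_Pow assms(3,8) by (simp add: sum.If_cases Int_absorb1 inf.absorb2)
    finally show ?thesis
      using r d assms(12) by (simp add: field_simps)
  qed

  define q where "q = p / L"
  \<comment> \<open>An integer number of edges that is at least \<open>r\<close> is at least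
    \<open>m\<close>; conversely \<open>r \<le> m\<close> will give
    \<open>exp r \<le> exp 1 ^ m\<close>.\<close>
  define m where "m = nat \<lceil>r\<rceil>"
  define G1 where "G1 = (\<lambda>(a, b). a \<union> b) ` (\<Union>y\<in>{1..<k}. pairs_meeting_in E y)"
  define G2 where "G2 = \<Union> ` {A. A \<subseteq> E \<and> card A = m \<and> pairwise disjnt A}"
  have q: "q \<ge> 0"
    using p L by (simp add: q_def)
  have m: "r \<le> real m" "m \<ge> 1"
    using r unfolding m_def by linarith+

  have G1_sub: "G1 \<subseteq> Pow X - {{}}"
    using E_edge by (fastforce simp: G1_def pairs_meeting_in_def)
  have G2_sub: "G2 \<subseteq> Pow X - {{}}"
  proof
    fix S
    assume "S \<in> G2"
    then obtain A where A: "S = \<Union>A" "A \<subseteq> E" "card A = m"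
      by (auto simp: G2_def)
    \<comment> \<open>Since \<open>m \<ge> 1\<close>, the union contains a nonempty edge.\<close>
    then obtain e where "e \<in> A"
      using m(2) by fastforce
    then show "S \<in> Pow X - {{}}"
      using A E_edge by blast
  qed

  \<comment> \<open>The covering property\<close>
  have "frac_upset X g \<subseteq> upset X (G1 \<union> G2)"
  proof
    fix S
    assume "S \<in> frac_upset X g"
    then have S: "S \<subseteq> X" "1 \<le> (\<Sum>T\<in>Pow S. g T)"
      by (auto simp: frac_upset_def)
    define B where "B = {T \<in> E. T \<subseteq> S}"
    have fin_S: "finite (Pow S)"
      using S(1) assms(3) finite_subset by blast
    have "(\<Sum>T\<in>Pow S. g T) = real (card (Pow S \<inter> E)) / r"
      using fin_S by (simp add: assms(10) sum.If_cases)
    also have "Pow S \<inter> E = B"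
      by (auto simp: B_def)
    finally have "1 \<le> real (card B) / r"
      using S(2) by simp
    then have "r \<le> real (card B)"
      using r by (simp add: field_simps)
    then have "m \<le> card B"
      unfolding m_def by linarith
    then obtain A where A: "A \<subseteq> B" "card A = m"
      using obtain_subset_with_card_n by metis
    show "S \<in> upset X (G1 \<union> G2)"
    proof (cases "pairwise disjnt A")
      case True
      then have "\<Union>A \<in> G2" "\<Union>A \<subseteq> S"
        using A by (auto simp: G2_def B_def)
      then show ?thesis
        using S(1) by (auto simp: upset_def)
    next
      case False
      then obtain a b where ab: "a \<in> A" "b \<in> A" "a \<noteq> b" "a \<inter> b \<noteq> {}"
        by (auto simp: pairwise_def disjnt_def)
      have abE: "a \<in> E" "b \<in> E" "a \<union> b \<subseteq> S"
        using ab A by (auto simp: B_def)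
      have "card (a \<inter> b) \<noteq> 0"
        using ab(4) E_edge(2)[OF abE(1)] by simp
      \<comment> \<open>Otherwise \<open>a \<subseteq> b\<close>, and equal sizes would force
        \<open>a = b\<close>.\<close>
      moreover have "a \<inter> b \<subset> a"
        using ab(3) card_subset_eq[of b a] E_edge[OF abE(1)] E_edge[OF abE(2)] by auto
      then have "card (a \<inter> b) < k"
        using psubset_card_mono[of a "a \<inter> b"] E_edge[OF abE(1)] by simp
      ultimately have "a \<union> b \<in> G1"
        using abE by (force simp: G1_def pairs_meeting_in_def)
      then show ?thesis
        using S(1) abE(3) unfolding upset_def by blast
    qed
  qed

  \<comment> \<open>The weight bound, one half for each family\<close>
  moreover have "weight (G1 \<union> G2) q \<le> 1"
  proof -
    have "real (card (pairs_meeting_in E y)) * q ^ (2 * k - y) \<le> L ^ y / L ^ k"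
      if y: "y \<in> {1..<k}" for y
    proof -
      let ?N = "real (card (pairs_meeting_in E y))"
      have y': "y \<in> {1..k - 1}"
        using y by auto
      have "?N * p ^ (2 * k - y)
          = ?N / real d ^ 2 * r powr (2 - real y / real k) * real d powr (real y / real k)"
        using power_eq_powr_ratio[OF p r d _ _ pk, of y] y by simp
      also have "\<dots> \<le> L ^ k"
        using bspec[OF assms(14) y'] prob_card_Int_eq[OF fin_E E_ne, of y]
        by (simp add: assms(8,13))
      finally have N: "?N * p ^ (2 * k - y) \<le> L ^ k" .
      \<comment> \<open>Passing from \<open>p\<close> to \<open>q\<close> gains
        \<open>L ^ (2 * k - y)\<close>, leaving a geometric sequence in \<open>y\<close>.\<close>
      have "L ^ (2 * k - y) * L ^ y = L ^ k * L ^ k"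
        using y by (simp flip: power_add mult_2)
      then have "L ^ k / L ^ (2 * k - y) = L ^ y / L ^ k"
        using L by (simp add: frac_eq_eq mult.commute)
      moreover have "?N * q ^ (2 * k - y) = ?N * p ^ (2 * k - y) / L ^ (2 * k - y)"
        by (simp add: q_def power_divide)
      moreover have "\<dots> \<le> L ^ k / L ^ (2 * k - y)"
        using N L by (intro divide_right_mono) auto
      ultimately show ?thesis
        by simp
    qed
    then have "(\<Sum>y\<in>{1..<k}. real (card (pairs_meeting_in E y)) * q ^ (2 * k - y))
        \<le> (\<Sum>y\<in>{1..<k}. L ^ y / L ^ k)"
      by (rule sum_mono)
    then have "weight G1 q \<le> (\<Sum>y\<in>{1..<k}. L ^ y / L ^ k)"
      unfolding G1_def using weight_pair_unions_le[OF fin_E _ q, of k] E_edge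
      by (meson order_trans)
    also have "\<dots> \<le> 1 / 2"
      using two_sum_power_le[of L k] L by (simp add: sum_divide_distrib[symmetric] field_simps)
    finally have G1: "weight G1 q \<le> 1 / 2" .

    have qk: "q ^ k = r / real d / L ^ k"
      unfolding q_def power_divide pk ..
    have "weight G2 q \<le> real (d choose m) * (q ^ k) ^ m"
      unfolding G2_def assms(8) by (rule weight_disjoint_unions_le[OF fin_E _ q]) (simp add: E_edge)
    also have "\<dots> = real (d choose m) * (r / real d) ^ m / (L ^ k) ^ m"
      by (simp only: qk power_divide times_divide_eq_right)
    \<comment> \<open>The choice \<open>t = r / d\<close> makes the exponent \<open>d * t\<close>
      equal to \<open>r\<close>.\<close>
    also have "\<dots> \<le> exp r / (L ^ k) ^ m"
      using choose_mult_power_le_exp[of "r / real d" d m] r d L by (intro divide_right_mono) auto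
    also have "\<dots> \<le> exp 1 ^ m / (L ^ k) ^ m"
      using m(1) L by (intro divide_right_mono) (auto simp flip: exp_of_nat_mult)
    also have "\<dots> = (exp 1 / L ^ k) ^ m"
      by (simp add: power_divide)
    \<comment> \<open>This is where \<open>L ^ k \<ge> 2 * exp 1\<close> enters.\<close>
    also have "\<dots> \<le> (1 / 2) ^ m"
      using Lk L by (intro power_mono) (auto simp: field_simps)
    also have "\<dots> \<le> 1 / 2"
      using power_decreasing[of 1 m "1 / 2 :: real"] m(2) by simp
    finally have G2: "weight G2 q \<le> 1 / 2" .

    have "finite G1" "finite G2"
      using G1_sub G2_sub assms(3) by (meson finite_Diff finite_Pow_iff finite_subset)+
    then show ?thesis
      using weight_Un_le[of G1 G2 q] q G1 G2 by simp
  qed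
  ultimately show ?thesis
    using G1_sub G2_sub unfolding q_def by (intro exI[of _ "G1 \<union> G2"]) simp
qed

end
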